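(* Let $G$ and $H$ be sequent calculi such that every sequent provable in $G$ is provable in $H$, and let $G$ consist of focused (resp. context-free focused) axioms. Then: (i) if $G$ and $H$ are single-conclusion and $H$ extends $\mathbf{FL_e}$ (resp. $\mathbf{FL_e}^-$), then $G$ has $H$-feasible interpolation; (ii) if $G$ and $H$ are multi-conclusion and $H$ extends $\mathbf{CFL_e}$ (resp. $\mathbf{CFL_e}^-$), then $G$ has strong $H$-feasible interpolation.
   Context: Formulas in a fixed propositional language containing $\wedge,\vee,\to,*,0,1,\top,\bot$ (and $+$ in the multi-conclusion case). $V(A)$: atoms of $A$ (for meta-formulas, also formula variables). Sequents $\Gamma\Rightarrow\Delta$, $\Gamma,\Delta$ finite multisets; single-conclusion if $|\Delta|\le1$. A calculus is a set of rule schemes over meta-formulas and meta-multiset variables; $H$ extends a calculus if every sequent provable in it is $H$-provable. $|O|$: length of a binary encoding. $\mathbf{FL_e}^-$: single-conclusion, axioms $\phi\Rightarrow\phi$, $\Rightarrow1$, $0\Rightarrow$; rules $\Gamma\Rightarrow\Delta/\Gamma,1\Rightarrow\Delta$; $\Gamma\Rightarrow/\Gamma\Rightarrow0$; standard $L\wedge,R\wedge,L\vee,R\vee$; $\Gamma,\phi,\psi\Rightarrow\Delta/\Gamma,\phi*\psi\Rightarrow\Delta$; $\Gamma\Rightarrow\phi\ \ \Sigma\Rightarrow\psi/\Gamma,\Sigma\Rightarrow\phi*\psi$; $\Gamma\Rightarrow\phi\ \ \Sigma,\psi\Rightarrow\Lambda/\Gamma,\Sigma,\phi\to\psi\Rightarrow\Lambda$;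 $\Gamma,\phi\Rightarrow\psi/\Gamma\Rightarrow\phi\to\psi$. $\mathbf{FL_e}$ adds $\Gamma\Rightarrow\top$ and $\Gamma,\bot\Rightarrow\Delta$. $\mathbf{CFL_e}^-,\mathbf{CFL_e}$: the multi-conclusion versions plus $\Gamma,\phi\Rightarrow\Delta\ \ \Sigma,\psi\Rightarrow\Lambda/\Gamma,\Sigma,\phi+\psi\Rightarrow\Delta,\Lambda$ and $\Gamma\Rightarrow\phi,\psi,\Delta/\Gamma\Rightarrow\phi+\psi,\Delta$. Focused axioms: (1) $\phi\Rightarrow\phi$; (2) $\Rightarrow\bar\alpha$; (3) $\bar\beta\Rightarrow$; (4) $\Gamma,\bar\phi\Rightarrow\Delta$; (5) $\Gamma\Rightarrow\bar\phi,\Delta$; in (2)–(5) any two elements of $\bar\alpha$ (resp. $\bar\beta,\bar\phi$) have the same variables and $\Gamma,\Delta$ are meta-multiset variables; (1)–(3) are the context-free focused axioms. $G$ has $H$-feasible interpolation if whenever $\Sigma,\Lambda\Rightarrow\Delta$ has a tree-like $G$-proof $\pi$ there is $C$ with $H\vdash\Sigma\Rightarrow C$, $H\vdash\Lambda,C\Rightarrow\Delta$, $V(C)\subseteq V(\Sigma)\cap V(\Lambda\cup\Delta)$ and $|C|\le|\pi|^{O(1)}$. Strong $H$-feasible interpolation: whenever $\Sigma,\Lambda\Rightarrow\Theta,\Delta$ has a tree-like $G$-proof $\pi$ there is $C$ with $H\vdash\Sigma\Rightarrow C,\Theta$, $H\vdash\Lambda,C\Rightarrow\Delta$, $V(C)\subseteq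 V(\Sigma\cup\Theta)\cap V(\Lambda\cup\Delta)$ and $|C|\le|\pi|^{O(1)}$.
   Formalization: "H extends K" is taken to mean that every rule of K is admissible in H, not only that H proves K's theorems; with mere inclusion the claim fails (H = theorems of FL_e plus the axiom ⇒p, G = {⇒p} has no interpolant). *)

theory Defs
  imports "HOL-Library.Multiset" "HOL-Library.List_Lexorder"
begin

datatype conn = CTop | CBot | COne | CZero | CAnd | COr | CImp | CFus | CPlus | COther nat

text \<open>A language is a set of connectives with their arities. The constructor \<open>COther\<close> is an
  unlimited supply of further connectives a language may contain.\<close>

type_synonym language = "(conn \<times> nat) set"

definition base_language :: language where
  "base_language =
    {(CAnd, 2), (COr, 2), (CImp, 2), (CFus, 2), (CZero, 0), (COne, 0), (CTop, 0), (CBot, 0)}"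

datatype (vars: 'a) fm = Atm 'a | App conn "'a fm list"

inductive_set formulas :: "language \<Rightarrow> 'a fm set" for L :: language where
  "Atm x \<in> formulas L"
| "(c, length As) \<in> L \<Longrightarrow> (\<And>A. A \<in> set As \<Longrightarrow> A \<in> formulas L) \<Longrightarrow> App c As \<in> formulas L"

abbreviation "Top \<equiv> App CTop []"
abbreviation "Bot \<equiv> App CBot []"
abbreviation "One \<equiv> App COne []"
abbreviation "Zero \<equiv> App CZero []"
abbreviation "And A B \<equiv> App CAnd [A, B]"
abbreviation "Or A B \<equiv> App COr [A, B]"
abbreviation "Imp A B \<equiv> App CImp [A, B]"
abbreviation "Fus A B \<equiv> App CFus [A, B]"
abbreviation "Plus A B \<equiv> App CPlus [A, B]"

type_synonym formula = "nat fm"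
type_synonym sequent = "formula multiset \<times> formula multiset"

definition V :: "'a fm multiset \<Rightarrow> 'a set" where
  "V M = (\<Union>A \<in> set_mset M. vars A)"


section \<open>Rule schemes and calculi\<close>

text \<open>Meta-formulas are built from atoms and formula variables, so \<^const>\<open>vars\<close> of a meta-formula
  collects both. A scheme for a multiset consists of meta-formulas and meta-multiset variables.\<close>

datatype mvar = PAtom nat | FVar nat

type_synonym mformula = "mvar fm"

datatype item = Frm mformula | Ctx nat

type_synonym msequent = "item multiset \<times> item multiset"
type_synonym rule_scheme = "msequent list \<times> msequent"

primrec subst_fm :: "(nat \<Rightarrow> formula) \<Rightarrow> mformula \<Rightarrow> formula" where
  "subst_fm \<sigma> (Atm x) = (case x of PAtom n \<Rightarrow> Atm n | FVar n \<Rightarrow> \<sigma> n)"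
| "subst_fm \<sigma> (App c As) = App c (map (subst_fm \<sigma>) As)"

primrec subst_item :: "(nat \<Rightarrow> formula) \<Rightarrow> (nat \<Rightarrow> formula multiset) \<Rightarrow> item \<Rightarrow> formula multiset" where
  "subst_item \<sigma> \<tau> (Frm A) = {#subst_fm \<sigma> A#}"
| "subst_item \<sigma> \<tau> (Ctx n) = \<tau> n"

definition subst_seq ::
    "(nat \<Rightarrow> formula) \<Rightarrow> (nat \<Rightarrow> formula multiset) \<Rightarrow> msequent \<Rightarrow> sequent" where
  "subst_seq \<sigma> \<tau> S = (\<Sum>i\<in>#fst S. subst_item \<sigma> \<tau> i, \<Sum>i\<in>#snd S. subst_item \<sigma> \<tau> i)"

datatype calculus = Calculus (single_conclusion: bool) (rules: "rule_scheme set")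

definition calculus_over :: "language \<Rightarrow> calculus \<Rightarrow> bool" where
  "calculus_over L K \<longleftrightarrow>
    (\<forall>(Ps, S) \<in> rules K. \<forall>T \<in> set (S # Ps). \<forall>A. Frm A \<in># fst T + snd T \<longrightarrow> A \<in> formulas L)"

text \<open>In a single-conclusion calculus only those instances of a scheme count all of whose sequents
  have at most one formula on the right.\<close>

definition rule_instance :: "language \<Rightarrow> calculus \<Rightarrow> sequent list \<Rightarrow> sequent \<Rightarrow> bool" where
  "rule_instance L K Ss S \<longleftrightarrow>
    (\<exists>(Ps, Q) \<in> rules K. \<exists>\<sigma> \<tau>.
       (\<forall>n. \<sigma> n \<in> formulas L) \<and> (\<forall>n. set_mset (\<tau> n) \<subseteq> formulas L) \<and>
       Ss = map (subst_seq \<sigma> \<tau>) Ps \<and> S = subst_seq \<sigma> \<tau> Q \<and>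
       (single_conclusion K \<longrightarrow> (\<forall>T \<in> set (S # Ss). size (snd T) \<le> 1)))"

datatype proof_tree = Node (root: sequent) (subproofs: "proof_tree list")

inductive proof_from :: "language \<Rightarrow> calculus \<Rightarrow> sequent set \<Rightarrow> proof_tree \<Rightarrow> bool"
  for L :: language and K :: calculus and X :: "sequent set" where
  hypothesis: "S \<in> X \<Longrightarrow> proof_from L K X (Node S [])"
| inference: "rule_instance L K (map root ts) S \<Longrightarrow> (\<And>t. t \<in> set ts \<Longrightarrow> proof_from L K X t)
    \<Longrightarrow> proof_from L K X (Node S ts)"

definition provable_from :: "language \<Rightarrow> calculus \<Rightarrow> sequent set \<Rightarrow> sequent \<Rightarrow> bool" where
  "provable_from L K X S \<longleftrightarrow> (\<exists>t. proof_from L K X t \<and> root t = S)"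

abbreviation provable :: "language \<Rightarrow> calculus \<Rightarrow> sequent \<Rightarrow> bool" where
  "provable L K \<equiv> provable_from L K {}"

text \<open>\<open>H\<close> extends \<open>K\<close>: whatever \<open>K\<close> proves, starting from sequents already proved in \<open>H\<close>, is
  provable in \<open>H\<close>; that is, every rule of \<open>K\<close> is admissible in \<open>H\<close>. Mere inclusion of the
  sets of theorems would be too weak for interpolation: let \<open>H\<close> consist of the theorems of
  \<open>FLe\<close> as axioms and the one further axiom \<open>\<Rightarrow> p\<close>, and let \<open>G\<close> be the axiom \<open>\<Rightarrow> p\<close>.
  An interpolant of \<open>\<Rightarrow> p\<close> would be a variable-free \<open>C\<close> for which \<open>FLe\<close> proves \<open>\<Rightarrow> C\<close> and
  \<open>C \<Rightarrow> p\<close>, which is impossible already for two-valued semantics.\<close>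

definition extends :: "language \<Rightarrow> calculus \<Rightarrow> calculus \<Rightarrow> bool" where
  "extends L H K \<longleftrightarrow> (\<forall>S. provable_from L K {T. provable L H T} S \<longrightarrow> provable L H S)"


section \<open>The calculi FLe and CFLe\<close>

text \<open>The parameters \<open>\<Pi>\<close> and \<open>\<Omega>\<close> are the side contexts next to a formula introduced on the right:
  empty in the single-conclusion calculi, meta-multiset variables in the multi-conclusion ones.\<close>

definition common_rules :: "item multiset \<Rightarrow> item multiset \<Rightarrow> rule_scheme set" where
  "common_rules \<Pi> \<Omega> = (let \<Gamma> = Ctx 0; \<Sigma> = Ctx 1; \<Delta> = Ctx 2; \<Lambda> = Ctx 3;
      \<phi> = Atm (FVar 0); \<psi> = Atm (FVar 1) in
    {([], ({#Frm \<phi>#}, {#Frm \<phi>#})),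
     ([], ({#}, {#Frm One#})),
     ([], ({#Frm Zero#}, {#})),
     ([({#\<Gamma>#}, {#\<Delta>#})], ({#\<Gamma>, Frm One#}, {#\<Delta>#})),
     ([({#\<Gamma>#}, \<Pi>)], ({#\<Gamma>#}, {#Frm Zero#} + \<Pi>)),
     ([({#\<Gamma>, Frm \<phi>#}, {#\<Delta>#})], ({#\<Gamma>, Frm (And \<phi> \<psi>)#}, {#\<Delta>#})),
     ([({#\<Gamma>, Frm \<psi>#}, {#\<Delta>#})], ({#\<Gamma>, Frm (And \<phi> \<psi>)#}, {#\<Delta>#})),
     ([({#\<Gamma>#}, {#Frm \<phi>#} + \<Pi>), ({#\<Gamma>#}, {#Frm \<psi>#} + \<Pi>)], ({#\<Gamma>#}, {#Frm (And \<phi> \<psi>)#} + \<Pi>)),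
     ([({#\<Gamma>, Frm \<phi>#}, {#\<Delta>#}), ({#\<Gamma>, Frm \<psi>#}, {#\<Delta>#})], ({#\<Gamma>, Frm (Or \<phi> \<psi>)#}, {#\<Delta>#})),
     ([({#\<Gamma>#}, {#Frm \<phi>#} + \<Pi>)], ({#\<Gamma>#}, {#Frm (Or \<phi> \<psi>)#} + \<Pi>)),
     ([({#\<Gamma>#}, {#Frm \<psi>#} + \<Pi>)], ({#\<Gamma>#}, {#Frm (Or \<phi> \<psi>)#} + \<Pi>)),
     ([({#\<Gamma>, Frm \<phi>, Frm \<psi>#}, {#\<Delta>#})], ({#\<Gamma>, Frm (Fus \<phi> \<psi>)#}, {#\<Delta>#})),
     ([({#\<Gamma>#}, {#Frm \<phi>#} + \<Pi>), ({#\<Sigma>#}, {#Frm \<psi>#} + \<Omega>)],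
       ({#\<Gamma>, \<Sigma>#}, {#Frm (Fus \<phi> \<psi>)#} + \<Pi> + \<Omega>)),
     ([({#\<Gamma>#}, {#Frm \<phi>#} + \<Pi>), ({#\<Sigma>, Frm \<psi>#}, {#\<Lambda>#})],
       ({#\<Gamma>, \<Sigma>, Frm (Imp \<phi> \<psi>)#}, \<Pi> + {#\<Lambda>#})),
     ([({#\<Gamma>, Frm \<phi>#}, {#Frm \<psi>#} + \<Pi>)], ({#\<Gamma>#}, {#Frm (Imp \<phi> \<psi>)#} + \<Pi>))})"

definition top_bot_axioms :: "item multiset \<Rightarrow> rule_scheme set" where
  "top_bot_axioms \<Pi> = (let \<Gamma> = Ctx 0; \<Delta> = Ctx 2 in
    {([], ({#\<Gamma>#}, {#Frm Top#} + \<Pi>)),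
     ([], ({#\<Gamma>, Frm Bot#}, {#\<Delta>#}))})"

definition plus_rules :: "rule_scheme set" where
  "plus_rules = (let \<Gamma> = Ctx 0; \<Sigma> = Ctx 1; \<Delta> = Ctx 2; \<Lambda> = Ctx 3;
      \<phi> = Atm (FVar 0); \<psi> = Atm (FVar 1) in
    {([({#\<Gamma>, Frm \<phi>#}, {#\<Delta>#}), ({#\<Sigma>, Frm \<psi>#}, {#\<Lambda>#})],
       ({#\<Gamma>, \<Sigma>, Frm (Plus \<phi> \<psi>)#}, {#\<Delta>, \<Lambda>#})),
     ([({#\<Gamma>#}, {#Frm \<phi>, Frm \<psi>, \<Delta>#})], ({#\<Gamma>#}, {#Frm (Plus \<phi> \<psi>), \<Delta>#}))})"

definition FLe_minus :: calculus where
  "FLe_minus = Calculus True (common_rules {#} {#})"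

definition FLe :: calculus where
  "FLe = Calculus True (common_rules {#} {#} \<union> top_bot_axioms {#})"

definition CFLe_minus :: calculus where
  "CFLe_minus = Calculus False (common_rules {#Ctx 2#} {#Ctx 3#} \<union> plus_rules)"

definition CFLe :: calculus where
  "CFLe = Calculus False
    (common_rules {#Ctx 2#} {#Ctx 3#} \<union> plus_rules \<union> top_bot_axioms {#Ctx 2#})"


section \<open>Focused axioms\<close>

definition same_vars :: "mformula multiset \<Rightarrow> bool" where
  "same_vars M \<longleftrightarrow> (\<forall>A \<in># M. \<forall>B \<in># M. vars A = vars B)"

definition context_free_focused_axiom :: "rule_scheme \<Rightarrow> bool" where
  "context_free_focused_axiom r \<longleftrightarrow>
    (\<exists>A. r = ([], ({#Frm A#}, {#Frm A#}))) \<or>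
    (\<exists>M. same_vars M \<and> r = ([], ({#}, image_mset Frm M))) \<or>
    (\<exists>M. same_vars M \<and> r = ([], (image_mset Frm M, {#})))"

text \<open>The flag \<open>s\<close> tells whether the calculus is single-conclusion. There the right context of an
  axiom \<open>\<Gamma> \<Rightarrow> A, \<Delta>\<close>, with at least one formula \<open>A\<close>, can only be
  instantiated by the empty multiset, and it may be left out of the scheme, as in the \<open>\<top>\<close>-axiom of \<open>FLe\<close>.\<close>

definition focused_axiom :: "bool \<Rightarrow> rule_scheme \<Rightarrow> bool" where
  "focused_axiom s r \<longleftrightarrow> context_free_focused_axiom r \<or>
    (\<exists>M g d. same_vars M \<and> g \<noteq> d \<and>
       (r = ([], ({#Ctx g#} + image_mset Frm M, {#Ctx d#})) \<or>
        r = ([], ({#Ctx g#}, image_mset Frm M + {#Ctx d#})) \<or>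
        s \<and> M \<noteq> {#} \<and> r = ([], ({#Ctx g#}, image_mset Frm M))))"

definition consists_of_focused_axioms :: "calculus \<Rightarrow> bool" where
  "consists_of_focused_axioms K \<longleftrightarrow> (\<forall>r \<in> rules K. focused_axiom (single_conclusion K) r)"

definition consists_of_context_free_focused_axioms :: "calculus \<Rightarrow> bool" where
  "consists_of_context_free_focused_axioms K \<longleftrightarrow> (\<forall>r \<in> rules K. context_free_focused_axiom r)"


section \<open>Binary encoding\<close>

fun binary :: "nat \<Rightarrow> bool list" where
  "binary n = (if n = 0 then [] else odd n # binary (n div 2))"

declare binary.simps [simp del]

text \<open>Self-delimiting: each bit is preceded by \<^const>\<open>True\<close>, and \<^const>\<open>False\<close> marks the end.\<close>

definition enc_nat :: "nat \<Rightarrow> bool list" where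
  "enc_nat n = concat (map (\<lambda>b. [True, b]) (binary n)) @ [False]"

fun conn_code :: "conn \<Rightarrow> nat" where
  "conn_code CTop = 0"
| "conn_code CBot = 1"
| "conn_code COne = 2"
| "conn_code CZero = 3"
| "conn_code CAnd = 4"
| "conn_code COr = 5"
| "conn_code CImp = 6"
| "conn_code CFus = 7"
| "conn_code CPlus = 8"
| "conn_code (COther n) = n + 9"

primrec enc_fm :: "formula \<Rightarrow> bool list" where
  "enc_fm (Atm n) = False # enc_nat n"
| "enc_fm (App c As) =
    True # enc_nat (conn_code c) @ enc_nat (length As) @ concat (map enc_fm As)"

text \<open>A multiset is listed in the order of the codes of its elements.\<close>

definition enc_mset :: "formula multiset \<Rightarrow> bool list" where
  "enc_mset M = enc_nat (size M) @ concat (sorted_list_of_multiset (image_mset enc_fm M))"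

definition enc_seq :: "sequent \<Rightarrow> bool list" where
  "enc_seq S = enc_mset (fst S) @ enc_mset (snd S)"

primrec enc_proof :: "proof_tree \<Rightarrow> bool list" where
  "enc_proof (Node S ts) = enc_seq S @ enc_nat (length ts) @ concat (map enc_proof ts)"


section \<open>Feasible interpolation\<close>

text \<open>The exponent \<open>k\<close> depends on the calculi only. Every proof has a code of length at least 3, so
  a bound of the form \<open>|\<pi>|^k\<close> is as general as an arbitrary polynomial one.\<close>

definition feasible_interpolation :: "language \<Rightarrow> calculus \<Rightarrow> calculus \<Rightarrow> bool" where
  "feasible_interpolation L H G \<longleftrightarrow>
    (\<exists>k. \<forall>\<Sigma> \<Lambda> \<Delta> \<pi>. proof_from L G {} \<pi> \<and> root \<pi> = (\<Sigma> + \<Lambda>, \<Delta>) \<longrightarrow>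
      (\<exists>C \<in> formulas L.
        provable L H (\<Sigma>, {#C#}) \<and> provable L H (\<Lambda> + {#C#}, \<Delta>) \<and>
        vars C \<subseteq> V \<Sigma> \<inter> V (\<Lambda> + \<Delta>) \<and>
        length (enc_fm C) \<le> length (enc_proof \<pi>) ^ k))"

definition strong_feasible_interpolation :: "language \<Rightarrow> calculus \<Rightarrow> calculus \<Rightarrow> bool" where
  "strong_feasible_interpolation L H G \<longleftrightarrow>
    (\<exists>k. \<forall>\<Sigma> \<Lambda> \<Theta> \<Delta> \<pi>. proof_from L G {} \<pi> \<and> root \<pi> = (\<Sigma> + \<Lambda>, \<Theta> + \<Delta>) \<longrightarrow>
      (\<exists>C \<in> formulas L.
        provable L H (\<Sigma>, {#C#} + \<Theta>) \<and> provable L H (\<Lambda> + {#C#}, \<Delta>) \<and>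
        vars C \<subseteq> V (\<Sigma> + \<Theta>) \<inter> V (\<Lambda> + \<Delta>) \<and>
        length (enc_fm C) \<le> length (enc_proof \<pi>) ^ k))"

end

theory Submission
  imports Defs
begin

text \<open>A calculus of axioms proves only axiom instances, so it suffices to interpolate each kind of
  focused axiom by an explicit formula. When the active formulas of the axiom are
  divided between the two parts, all of them have the same variables; so the active formulas of one
  part, joined by fusion (on the left) or by plus (on the right), have only common variables. In
  axioms with contexts, fusion with \<open>\<top>\<close> or plus with \<open>\<bottom>\<close> absorbs the
  passive formulas. The single-conclusion case is the case \<open>\<Theta> = \<emptyset>\<close> of the
  multi-conclusion one.\<close>

section \<open>Iterated connectives and the length of codes\<close>

primrec fusion :: "formula list \<Rightarrow> formula" where
  "fusion [] = One"
| "fusion (A # As) = Fus A (fusion As)"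

primrec psum :: "formula list \<Rightarrow> formula" where
  "psum [] = Zero"
| "psum (A # As) = Plus A (psum As)"

definition weight :: "formula multiset \<Rightarrow> nat" where
  "weight M = (\<Sum>A\<in>#M. length (enc_fm A))"

lemma V_simps [simp]: "V {#} = {}" "V (add_mset A M) = vars A \<union> V M" "V (M + N) = V M \<union> V N"
  by (auto simp: V_def)

lemma weight_simps [simp]:
  "weight {#} = 0" "weight (add_mset A M) = length (enc_fm A) + weight M"
  "weight (M + N) = weight M + weight N"
  by (auto simp: weight_def)

lemma vars_fusion: "vars (fusion As) = V (mset As)"
  by (induction As) auto

lemma vars_psum: "vars (psum As) = V (mset As)"
  by (induction As) auto

text \<open>These arguments are the codes and arities of the connectives from which interpolants are
  built.\<close>

lemma length_enc_nat [simp]: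
  "length (enc_nat 0) = 1" "length (enc_nat (Suc 0)) = 3" "length (enc_nat 2) = 5"
  "length (enc_nat 3) = 5" "length (enc_nat 6) = 7" "length (enc_nat 7) = 7"
  "length (enc_nat 8) = 9" "length (enc_nat (Suc (Suc 0))) = 5"
  by (simp_all add: enc_nat_def binary.simps)

lemma length_enc_nat_pos: "length (enc_nat n) \<ge> 1"
  by (simp add: enc_nat_def)

lemma length_enc_fm_ge: "length (enc_fm A) \<ge> 2"
proof (cases A)
  case (Atm n)
  then show ?thesis using length_enc_nat_pos[of n] by simp
next
  case (App c As)
  then show ?thesis using length_enc_nat_pos[of "conn_code c"] by simp
qed

text \<open>Each \<open>Fus\<close> costs 13 bits besides its arguments, at most 8 times the code of
  the head formula, which has at least 2 bits. The 7 is the code length of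
  \<open>One\<close>.\<close>

lemma length_enc_fusion: "length (enc_fm (fusion As)) \<le> 9 * weight (mset As) + 7"
proof (induction As)
  case (Cons A As)
  then show ?case using length_enc_fm_ge[of A] by simp
qed simp

text \<open>\<open>Plus\<close> costs 15 bits, still at most 8 times a code length of at least 2;
  this is what fixes the factor 9. The 7 is now the code length of \<open>Zero\<close>.\<close>

lemma length_enc_psum: "length (enc_fm (psum As)) \<le> 9 * weight (mset As) + 7"
proof (induction As)
  case (Cons A As)
  then show ?case using length_enc_fm_ge[of A] by simp
qed simp

lemma weight_le_length_enc_mset: "weight M + 1 \<le> length (enc_mset M)"
proof -
  have "length (concat (sorted_list_of_multiset (image_mset enc_fm M)))
      = sum_mset (image_mset length (mset (sorted_list_of_multiset (image_mset enc_fm M))))"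
    by (metis length_concat sum_mset_sum_list mset_map)
  also have "\<dots> = weight M"
    by (simp add: weight_def image_mset.compositionality o_def)
  finally show ?thesis
    using length_enc_nat_pos[of "size M"] by (simp add: enc_mset_def)
qed

text \<open>The 3 counts the delimiting bits: one for the size of each side of the sequent and one
  for the number of subproofs. It later absorbs the additive constant of the size bound.\<close>

lemma weight_le_length_enc_proof:
  "weight (fst S) + weight (snd S) + 3 \<le> length (enc_proof (Node S ts))"
  using weight_le_length_enc_mset[of "fst S"] weight_le_length_enc_mset[of "snd S"]
    length_enc_nat_pos[of "length ts"]
  by (simp add: enc_seq_def)


section \<open>Multisets of formulas with the same variables\<close>

definition uniform :: "formula multiset \<Rightarrow> bool" where
  "uniform M \<longleftrightarrow> (\<forall>A \<in># M. \<forall>B \<in># M. vars A = vars B)"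

text \<open>Any single member of \<open>M\<close> already has all the variables of \<open>N\<close>.
  This is how an interpolant built from the active formulas of one part satisfies the variable
  condition for the other part.\<close>

lemma uniform_V: "uniform (M + N) \<Longrightarrow> M \<noteq> {#} \<Longrightarrow> V N \<subseteq> V M"
  by (auto simp: uniform_def V_def) blast

text \<open>The right-hand side mentions \<open>A\<close> only through \<open>vars A\<close>, so
  meta-formulas with the same variables have instances with the same variables.\<close>

lemma vars_subst_fm:
  "vars (subst_fm \<sigma> A) = (\<Union>x \<in> vars A. case x of PAtom n \<Rightarrow> {n} | FVar n \<Rightarrow> vars (\<sigma> n))"
  by (induction A) (auto split: mvar.splits)

lemma uniform_subst: "same_vars M \<Longrightarrow> uniform (image_mset (subst_fm \<sigma>) M)"
proof -
  assume M: "same_vars M"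
  have "vars (subst_fm \<sigma> A) = vars (subst_fm \<sigma> B)" if "A \<in># M" "B \<in># M" for A B
  proof -
    have "vars A = vars B"
      using M that unfolding same_vars_def by blast
    then show ?thesis
      by (simp only: vars_subst_fm)
  qed
  then show ?thesis
    unfolding uniform_def set_image_mset by blast
qed

text \<open>In use, \<open>M\<close> holds the active formulas of an axiom and \<open>X\<close> a
  passive context, while \<open>A\<close> and \<open>B\<close> are the two parts between which the
  sequent is divided.\<close>

lemma mset_split:
  assumes "A + B = X + (M :: 'a multiset)"
  shows "\<exists>A1 A2 B1 B2. A = A1 + A2 \<and> B = B1 + B2 \<and> M = A1 + B1 \<and> X = A2 + B2"
proof (intro exI conjI)
  have eq: "count A x + count B x = count X x + count M x" for x
    using assms by (metis count_union)
  \<comment> \<open>The choice is greedy: \<open>A\<close> supplies as much of \<open>M\<close> as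
    it can, and the remainder \<open>M - A\<close> must then fit into \<open>B\<close>.\<close>
  show "A = (A \<inter># M) + (A - M)" "M = (A \<inter># M) + (M - A)"
    by (auto simp: multiset_eq_iff)
  show "B = (M - A) + (B - (M - A))"
  proof (rule multiset_eqI)
    show "count B x = count ((M - A) + (B - (M - A))) x" for x
      using eq[of x] by simp
  qed
  show "X = (A - M) + (B - (M - A))"
  proof (rule multiset_eqI)
    show "count X x = count ((A - M) + (B - (M - A))) x" for x
      using eq[of x] by simp
  qed
qed


section \<open>Rule instances\<close>

text \<open>The rule schemes of the base calculi use two formula variables and four context
  variables. Here and in \<open>ctx_subst\<close> the last value doubles as the default for all
  larger indices, which keeps the whole substitution inside the language.\<close>

definition fm_subst :: "formula \<Rightarrow> formula \<Rightarrow> nat \<Rightarrow> formula" where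
  "fm_subst A B n = (if n = 0 then A else B)"

definition ctx_subst :: "formula multiset \<Rightarrow> formula multiset \<Rightarrow> formula multiset \<Rightarrow>
    formula multiset \<Rightarrow> nat \<Rightarrow> formula multiset" where
  "ctx_subst \<Gamma> \<Sigma> \<Delta> \<Lambda> n = (if n = 0 then \<Gamma> else if n = 1 then \<Sigma> else if n = 2 then \<Delta> else \<Lambda>)"

lemma subst_simps [simp]:
  "fm_subst A B 0 = A" "fm_subst A B (Suc 0) = B"
  "ctx_subst \<Gamma> \<Sigma> \<Delta> \<Lambda> 0 = \<Gamma>" "ctx_subst \<Gamma> \<Sigma> \<Delta> \<Lambda> (Suc 0) = \<Sigma>"
  "ctx_subst \<Gamma> \<Sigma> \<Delta> \<Lambda> 2 = \<Delta>" "ctx_subst \<Gamma> \<Sigma> \<Delta> \<Lambda> 3 = \<Lambda>"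
  by (simp_all add: fm_subst_def ctx_subst_def)

lemma rule_instanceI:
  assumes "(Ps, Q) \<in> rules K" "\<And>n. \<sigma> n \<in> formulas L" "\<And>n. set_mset (\<tau> n) \<subseteq> formulas L"
    and "single_conclusion K \<Longrightarrow> \<forall>T \<in> set (Q # Ps). size (snd (subst_seq \<sigma> \<tau> T)) \<le> 1"
  shows "rule_instance L K (map (subst_seq \<sigma> \<tau>) Ps) (subst_seq \<sigma> \<tau> Q)"
  unfolding rule_instance_def
  apply (rule bexI[OF _ assms(1)])
  apply (simp only: prod.case)
  apply (rule exI[of _ \<sigma>], rule exI[of _ \<tau>])
  using assms(2-4) by auto

text \<open>A tree of height one suffices: its leaves are hypotheses already proved in
  \<open>H\<close>, and its root is the given inference. Thus the rules of \<open>K\<close> are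
  admissible in \<open>H\<close>.\<close>

lemma extends_rule:
  assumes "extends L H K" "rule_instance L K Ss S" "\<forall>T \<in> set Ss. provable L H T"
  shows "provable L H S"
proof -
  let ?t = "Node S (map (\<lambda>T. Node T []) Ss)"
  have "proof_from L K {T. provable L H T} ?t"
  proof (rule proof_from.inference)
    show "rule_instance L K (map root (map (\<lambda>T. Node T []) Ss)) S"
      using assms(2) by (simp add: o_def)
    show "proof_from L K {T. provable L H T} t" if "t \<in> set (map (\<lambda>T. Node T []) Ss)" for t
      using that assms(3) by (auto intro: proof_from.hypothesis)
  qed
  then have "provable_from L K {T. provable L H T} S"
    unfolding provable_from_def by (intro exI[of _ ?t]) simp
  then show ?thesis
    using assms(1) unfolding extends_def by blast
qed

section \<open>Instances of focused axioms\<close>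

lemma subst_fm_formula:
  assumes "A \<in> formulas L" "\<And>n. \<sigma> n \<in> formulas L"
  shows "subst_fm \<sigma> A \<in> formulas L"
  using assms(1)
proof induction
  case (1 x)
  then show ?case using assms(2) by (auto intro: formulas.intros split: mvar.splits)
next
  case (2 c As)
  then show ?case by (auto intro!: formulas.intros(2))
qed

lemma rule_instance_formulas:
  assumes "calculus_over L K" "rule_instance L K Ss S"
  shows "set_mset (fst S) \<subseteq> formulas L" "set_mset (snd S) \<subseteq> formulas L"
proof -
  obtain Ps Q \<sigma> \<tau> where r: "(Ps, Q) \<in> rules K" "\<And>n. \<sigma> n \<in> formulas L"
    "\<And>n. set_mset (\<tau> n) \<subseteq> formulas L" "S = subst_seq \<sigma> \<tau> Q"
    using assms(2) unfolding rule_instance_def by blast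
  have "set_mset (subst_item \<sigma> \<tau> i) \<subseteq> formulas L" if "i \<in># fst Q + snd Q" for i
  proof (cases i)
    case (Frm A)
    then have "A \<in> formulas L"
      using assms(1) r(1) that unfolding calculus_over_def by fastforce
    then show ?thesis using Frm subst_fm_formula r(2) by simp
  next
    case (Ctx n)
    then show ?thesis using r(3) by simp
  qed
  then show "set_mset (fst S) \<subseteq> formulas L" "set_mset (snd S) \<subseteq> formulas L"
    unfolding r(4) subst_seq_def by (fastforce simp: set_mset_Union_mset)+
qed

lemma axiom_provable:
  assumes "([], Q) \<in> rules K" "\<And>n. \<sigma> n \<in> formulas L" "\<And>n. set_mset (\<tau> n) \<subseteq> formulas L"
    and "single_conclusion K \<Longrightarrow> size (snd (subst_seq \<sigma> \<tau> Q)) \<le> 1"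
  shows "provable L K (subst_seq \<sigma> \<tau> Q)"
proof -
  have "rule_instance L K (map root []) (subst_seq \<sigma> \<tau> Q)"
    using rule_instanceI[OF assms(1-3)] assms(4) by simp
  then have "proof_from L K {} (Node (subst_seq \<sigma> \<tau> Q) [])"
    by (rule proof_from.inference) simp
  then show ?thesis
    unfolding provable_from_def by (intro exI[of _ "Node (subst_seq \<sigma> \<tau> Q) []"]) simp
qed

lemma subst_frms: "(\<Sum>i\<in>#image_mset Frm M. subst_item \<sigma> \<tau> i) = image_mset (subst_fm \<sigma>) M"
  by (induction M) auto

lemma context_free_instance_cases:
  assumes "context_free_focused_axiom (Ps, Q)"
  obtains (identity) A where "subst_seq \<sigma> \<tau> Q = ({#A#}, {#A#})"
  | (right) M where "uniform M" "subst_seq \<sigma> \<tau> Q = ({#}, M)"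
  | (left) M where "uniform M" "subst_seq \<sigma> \<tau> Q = (M, {#})"
  using assms unfolding context_free_focused_axiom_def
proof (elim disjE exE conjE)
  fix A assume "(Ps, Q) = ([], ({#Frm A#}, {#Frm A#}))"
  then show ?thesis by (intro identity[of "subst_fm \<sigma> A"]) (simp add: subst_seq_def)
next
  fix M assume "same_vars M" "(Ps, Q) = ([], ({#}, image_mset Frm M))"
  then show ?thesis
    by (intro right[of "image_mset (subst_fm \<sigma>) M"]) (simp_all add: subst_seq_def subst_frms uniform_subst)
next
  fix M assume "same_vars M" "(Ps, Q) = ([], (image_mset Frm M, {#}))"
  then show ?thesis
    by (intro left[of "image_mset (subst_fm \<sigma>) M"]) (simp_all add: subst_seq_def subst_frms uniform_subst)
qed

text \<open>The cases with contexts also return the axiom with its contexts chosen afresh, because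
  the two sequents of an interpolation have other contexts than the given instance. On the right of
  a single-conclusion axiom the old context is kept, so the size bound of the given instance carries
  over.\<close>

lemma focused_instance_cases:
  assumes "focused_axiom (single_conclusion K) (Ps, Q)" "(Ps, Q) \<in> rules K"
    and \<sigma>: "\<And>n. \<sigma> n \<in> formulas L"
    and size: "single_conclusion K \<longrightarrow> size (snd (subst_seq \<sigma> \<tau> Q)) \<le> 1"
  obtains (context_free) "context_free_focused_axiom (Ps, Q)"
  | (context_left) \<Gamma> M \<Delta> where "uniform M" "subst_seq \<sigma> \<tau> Q = (\<Gamma> + M, \<Delta>)"
      "\<And>\<Gamma>' \<Delta>'. set_mset \<Gamma>' \<subseteq> formulas L \<Longrightarrow> set_mset \<Delta>' \<subseteq> formulas L \<Longrightarrow>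
        (single_conclusion K \<Longrightarrow> size \<Delta>' \<le> 1) \<Longrightarrow> provable L K (\<Gamma>' + M, \<Delta>')"
  | (context_right) \<Gamma> M \<Delta> where "uniform M" "subst_seq \<sigma> \<tau> Q = (\<Gamma>, \<Delta> + M)"
      "\<And>\<Gamma>' \<Delta>'. set_mset \<Gamma>' \<subseteq> formulas L \<Longrightarrow> set_mset \<Delta>' \<subseteq> formulas L \<Longrightarrow>
        (single_conclusion K \<Longrightarrow> \<Delta>' = \<Delta>) \<Longrightarrow> provable L K (\<Gamma>', \<Delta>' + M)"
  using assms(1) unfolding focused_axiom_def
proof (elim disjE exE conjE)
  fix M g d assume M: "same_vars M" "g \<noteq> d"
    and eq: "(Ps, Q) = ([], ({#Ctx g#} + image_mset Frm M, {#Ctx d#}))"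
  let ?M = "image_mset (subst_fm \<sigma>) M"
  have sub: "subst_seq \<sigma> \<tau>' Q = (\<tau>' g + ?M, \<tau>' d)" for \<tau>'
    using eq by (simp add: subst_seq_def subst_frms)
  show ?thesis
  proof (rule context_left[OF uniform_subst[OF M(1)] sub])
    fix \<Gamma>' \<Delta>' :: "formula multiset"
    assume "set_mset \<Gamma>' \<subseteq> formulas L" "set_mset \<Delta>' \<subseteq> formulas L"
      "single_conclusion K \<Longrightarrow> size \<Delta>' \<le> 1"
    then show "provable L K (\<Gamma>' + ?M, \<Delta>')"
      \<comment> \<open>Since \<open>g\<close> and \<open>d\<close> differ, the left and the right
        context can be chosen independently.\<close>
      using axiom_provable[of Q K \<sigma> L "\<lambda>n. if n = g then \<Gamma>' else \<Delta>'"] assms(2) eq M(2) \<sigma>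
      by (simp add: sub)
  qed
next
  fix M g d assume M: "same_vars M" "g \<noteq> d"
    and eq: "(Ps, Q) = ([], ({#Ctx g#}, image_mset Frm M + {#Ctx d#}))"
  let ?M = "image_mset (subst_fm \<sigma>) M"
  have sub: "subst_seq \<sigma> \<tau>' Q = (\<tau>' g, \<tau>' d + ?M)" for \<tau>'
    using eq by (simp add: subst_seq_def subst_frms)
  note size' = size[unfolded sub snd_conv]
  show ?thesis
  proof (rule context_right[OF uniform_subst[OF M(1)] sub])
    fix \<Gamma>' \<Delta>' :: "formula multiset"
    assume "set_mset \<Gamma>' \<subseteq> formulas L" "set_mset \<Delta>' \<subseteq> formulas L"
      "single_conclusion K \<Longrightarrow> \<Delta>' = \<tau> d"
    then show "provable L K (\<Gamma>', \<Delta>' + ?M)"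
      using axiom_provable[of Q K \<sigma> L "\<lambda>n. if n = g then \<Gamma>' else \<Delta>'"] assms(2) eq M(2) \<sigma> size'
      by (simp add: sub)
  qed
next
  fix M g d assume M: "same_vars M" and K: "single_conclusion K"
    and eq: "(Ps, Q) = ([], ({#Ctx g#}, image_mset Frm M))"
  let ?M = "image_mset (subst_fm \<sigma>) M"
  \<comment> \<open>The explicit empty multiset plays the right context, so that this scheme fits
    the case \<open>context_right\<close>.\<close>
  have sub: "subst_seq \<sigma> \<tau>' Q = (\<tau>' g, {#} + ?M)" for \<tau>'
    using eq by (simp add: subst_seq_def subst_frms)
  note size' = size[unfolded sub snd_conv]
  show ?thesis
  proof (rule context_right[OF uniform_subst[OF M] sub])
    fix \<Gamma>' \<Delta>' :: "formula multiset"
    assume "set_mset \<Gamma>' \<subseteq> formulas L" "single_conclusion K \<Longrightarrow> \<Delta>' = {#}"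
    then show "provable L K (\<Gamma>', \<Delta>' + ?M)"
      using axiom_provable[of Q K \<sigma> L "\<lambda>n. \<Gamma>'"] assms(2) eq \<sigma> size' K
      by (simp add: sub)
  qed
qed


section \<open>Admissible rules in extensions of FLe\<close>

text \<open>\<open>K\<close> is one of the four calculi \<open>FLe_minus\<close>, \<open>FLe\<close>, \<open>CFLe_minus\<close>, \<open>CFLe\<close>.\<close>

locale fle_extension =
  fixes L :: language and H K :: calculus and s :: bool
  assumes base: "base_language \<subseteq> L"
    and ext: "extends L H K"
    and single: "single_conclusion K = s"
    and common: "common_rules (if s then {#} else {#Ctx 2#}) (if s then {#} else {#Ctx 3#}) \<subseteq> rules K"
    and plus: "\<not> s \<Longrightarrow> (CPlus, 2) \<in> L \<and> plus_rules \<subseteq> rules K"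
begin

abbreviation wf :: "formula multiset \<Rightarrow> bool" where
  "wf M \<equiv> set_mset M \<subseteq> formulas L"

abbreviation derives :: "formula multiset \<Rightarrow> formula multiset \<Rightarrow> bool" (infix "\<tturnstile>" 50) where
  "\<Gamma> \<tturnstile> \<Delta> \<equiv> provable L H (\<Gamma>, \<Delta>)"

lemma formulas_base [simp, intro]:
  "Top \<in> formulas L" "Bot \<in> formulas L" "One \<in> formulas L" "Zero \<in> formulas L"
  "A \<in> formulas L \<Longrightarrow> B \<in> formulas L \<Longrightarrow> Fus A B \<in> formulas L"
  "A \<in> formulas L \<Longrightarrow> B \<in> formulas L \<Longrightarrow> Imp A B \<in> formulas L"
  "\<not> s \<Longrightarrow> A \<in> formulas L \<Longrightarrow> B \<in> formulas L \<Longrightarrow> Plus A B \<in> formulas L"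
  using base plus by (auto simp: base_language_def numeral_2_eq_2 intro!: formulas.intros(2))

text \<open>Using a rule in \<open>H\<close> is hereby reduced to finding its scheme in
  \<open>K\<close> and evaluating one fixed pair of substitutions.\<close>

lemma apply_rule:
  assumes "(Ps, Q) \<in> rules K"
    and "A \<in> formulas L" "B \<in> formulas L" "wf \<Gamma>" "wf \<Sigma>" "wf \<Delta>" "wf \<Lambda>"
    and "\<forall>T \<in> set Ps. provable L H (subst_seq (fm_subst A B) (ctx_subst \<Gamma> \<Sigma> \<Delta> \<Lambda>) T)"
    and "s \<Longrightarrow> \<forall>T \<in> set (Q # Ps). size (snd (subst_seq (fm_subst A B) (ctx_subst \<Gamma> \<Sigma> \<Delta> \<Lambda>) T)) \<le> 1"
  shows "provable L H (subst_seq (fm_subst A B) (ctx_subst \<Gamma> \<Sigma> \<Delta> \<Lambda>) Q)"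
proof -
  let ?f = "subst_seq (fm_subst A B) (ctx_subst \<Gamma> \<Sigma> \<Delta> \<Lambda>)"
  have "rule_instance L K (map ?f Ps) (?f Q)"
    using assms single
    by (intro rule_instanceI) (auto simp: fm_subst_def ctx_subst_def)
  then show ?thesis
    using extends_rule[OF ext] assms(8) by simp
qed

abbreviation side1 :: "item multiset" where
  "side1 \<equiv> if s then {#} else {#Ctx 2#}"

abbreviation side2 :: "item multiset" where
  "side2 \<equiv> if s then {#} else {#Ctx 3#}"

section \<open>The individual rules of the base calculi, as admissible rules of
  \<open>H\<close>\<close>

lemma identity:
  assumes "A \<in> formulas L"
  shows "{#A#} \<tturnstile> {#A#}"
proof -
  have "([],
      ({#Frm (Atm (FVar 0))#}, {#Frm (Atm (FVar 0))#})) \<in> common_rules side1 side2"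
    unfolding common_rules_def Let_def by (rule insertI1 | rule insertI2)+
  from apply_rule[OF subsetD[OF common this], of A A "{#}" "{#}" "{#}" "{#}"] show ?thesis
    using assms by (auto simp: subst_seq_def add_ac)
qed

lemma one_right:
  shows "{#} \<tturnstile> {#One#}"
proof -
  have "([],
      ({#}, {#Frm One#})) \<in> common_rules side1 side2"
    unfolding common_rules_def Let_def by (rule insertI1 | rule insertI2)+
  from apply_rule[OF subsetD[OF common this], of One One "{#}" "{#}" "{#}" "{#}"] show ?thesis
    by (auto simp: subst_seq_def add_ac)
qed

lemma zero_left:
  shows "{#Zero#} \<tturnstile> {#}"
proof -
  have "([],
      ({#Frm Zero#}, {#})) \<in> common_rules side1 side2"
    unfolding common_rules_def Let_def by (rule insertI1 | rule insertI2)+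
  from apply_rule[OF subsetD[OF common this], of One One "{#}" "{#}" "{#}" "{#}"] show ?thesis
    by (auto simp: subst_seq_def add_ac)
qed

lemma one_left:
  assumes "\<Gamma> \<tturnstile> \<Delta>" "wf \<Gamma>" "wf \<Delta>" "s \<Longrightarrow> size \<Delta> \<le> 1"
  shows "\<Gamma> + {#One#} \<tturnstile> \<Delta>"
proof -
  have "([({#Ctx 0#}, {#Ctx 2#})],
      ({#Ctx 0, Frm One#}, {#Ctx 2#})) \<in> common_rules side1 side2"
    unfolding common_rules_def Let_def by (rule insertI1 | rule insertI2)+
  from apply_rule[OF subsetD[OF common this], of One One \<Gamma> "{#}" \<Delta> "{#}"] show ?thesis
    using assms by (auto simp: subst_seq_def add_ac)
qed

lemma zero_right:
  assumes "\<Gamma> \<tturnstile> \<Delta>" "wf \<Gamma>" "wf \<Delta>" "s \<Longrightarrow> \<Delta> = {#}"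
  shows "\<Gamma> \<tturnstile> {#Zero#} + \<Delta>"
proof -
  have "([({#Ctx 0#}, side1)],
      ({#Ctx 0#}, {#Frm Zero#} + side1)) \<in> common_rules side1 side2"
    unfolding common_rules_def Let_def by (rule insertI1 | rule insertI2)+
  from apply_rule[OF subsetD[OF common this], of One One \<Gamma> "{#}" \<Delta> "{#}"] show ?thesis
    using assms by (cases s) (auto simp: subst_seq_def add_ac)
qed

lemma fus_left:
  assumes "\<Gamma> + {#A#} + {#B#} \<tturnstile> \<Delta>" "wf \<Gamma>" "wf \<Delta>" "A \<in> formulas L" "B \<in> formulas L"
    "s \<Longrightarrow> size \<Delta> \<le> 1"
  shows "\<Gamma> + {#Fus A B#} \<tturnstile> \<Delta>"
proof -
  have "([({#Ctx 0, Frm (Atm (FVar 0)), Frm (Atm (FVar 1))#}, {#Ctx 2#})],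
      ({#Ctx 0, Frm (Fus (Atm (FVar 0)) (Atm (FVar 1)))#}, {#Ctx 2#})) \<in> common_rules side1 side2"
    unfolding common_rules_def Let_def by (rule insertI1 | rule insertI2)+
  from apply_rule[OF subsetD[OF common this], of A B \<Gamma> "{#}" \<Delta> "{#}"] show ?thesis
    using assms by (auto simp: subst_seq_def add_ac)
qed

lemma fus_right:
  assumes "\<Gamma> \<tturnstile> {#A#} + \<Delta>" "\<Sigma> \<tturnstile> {#B#} + \<Lambda>" "wf \<Gamma>" "wf \<Sigma>" "wf \<Delta>" "wf \<Lambda>"
    "A \<in> formulas L" "B \<in> formulas L" "s \<Longrightarrow> \<Delta> = {#} \<and> \<Lambda> = {#}"
  shows "\<Gamma> + \<Sigma> \<tturnstile> {#Fus A B#} + \<Delta> + \<Lambda>"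
proof -
  have "([({#Ctx 0#}, {#Frm (Atm (FVar 0))#} + side1), ({#Ctx 1#}, {#Frm (Atm (FVar 1))#} + side2)],
      ({#Ctx 0, Ctx 1#}, {#Frm (Fus (Atm (FVar 0)) (Atm (FVar 1)))#} + side1 + side2)) \<in> common_rules side1 side2"
    unfolding common_rules_def Let_def by (rule insertI1 | rule insertI2)+
  from apply_rule[OF subsetD[OF common this], of A B \<Gamma> \<Sigma> \<Delta> \<Lambda>] show ?thesis
    using assms by (cases s) (auto simp: subst_seq_def add_ac)
qed

lemma imp_left:
  assumes "\<Gamma> \<tturnstile> {#A#} + \<Delta>" "\<Sigma> + {#B#} \<tturnstile> \<Lambda>" "wf \<Gamma>" "wf \<Sigma>" "wf \<Delta>" "wf \<Lambda>"
    "A \<in> formulas L" "B \<in> formulas L" "\<not> s"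
  shows "\<Gamma> + \<Sigma> + {#Imp A B#} \<tturnstile> \<Delta> + \<Lambda>"
proof -
  have "([({#Ctx 0#}, {#Frm (Atm (FVar 0))#} + side1), ({#Ctx 1, Frm (Atm (FVar 1))#}, {#Ctx 3#})],
      ({#Ctx 0, Ctx 1, Frm (Imp (Atm (FVar 0)) (Atm (FVar 1)))#}, side1 + {#Ctx 3#})) \<in> common_rules side1 side2"
    unfolding common_rules_def Let_def by (rule insertI1 | rule insertI2)+
  from apply_rule[OF subsetD[OF common this], of A B \<Gamma> \<Sigma> \<Delta> \<Lambda>] show ?thesis
    using assms by (auto simp: subst_seq_def add_ac)
qed

lemma imp_right:
  assumes "\<Gamma> + {#A#} \<tturnstile> {#B#} + \<Delta>" "wf \<Gamma>" "wf \<Delta>" "A \<in> formulas L" "B \<in> formulas L" "\<not> s"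
  shows "\<Gamma> \<tturnstile> {#Imp A B#} + \<Delta>"
proof -
  have "([({#Ctx 0, Frm (Atm (FVar 0))#}, {#Frm (Atm (FVar 1))#} + side1)],
      ({#Ctx 0#}, {#Frm (Imp (Atm (FVar 0)) (Atm (FVar 1)))#} + side1)) \<in> common_rules side1 side2"
    unfolding common_rules_def Let_def by (rule insertI1 | rule insertI2)+
  from apply_rule[OF subsetD[OF common this], of A B \<Gamma> "{#}" \<Delta> "{#}"] show ?thesis
    using assms by (auto simp: subst_seq_def add_ac)
qed

lemma plus_left:
  assumes "\<Gamma> + {#A#} \<tturnstile> \<Delta>" "\<Sigma> + {#B#} \<tturnstile> \<Lambda>" "wf \<Gamma>" "wf \<Sigma>" "wf \<Delta>" "wf \<Lambda>"
    "A \<in> formulas L" "B \<in> formulas L" "\<not> s"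
  shows "\<Gamma> + \<Sigma> + {#Plus A B#} \<tturnstile> \<Delta> + \<Lambda>"
proof -
  have "([({#Ctx 0, Frm (Atm (FVar 0))#}, {#Ctx 2#}), ({#Ctx 1, Frm (Atm (FVar 1))#}, {#Ctx 3#})],
      ({#Ctx 0, Ctx 1, Frm (Plus (Atm (FVar 0)) (Atm (FVar 1)))#}, {#Ctx 2, Ctx 3#})) \<in> plus_rules"
    unfolding plus_rules_def Let_def by (rule insertI1 | rule insertI2)+
  from apply_rule[OF subsetD[OF conjunct2[OF plus[OF assms(9)]] this], of A B \<Gamma> \<Sigma> \<Delta> \<Lambda>] show ?thesis
    using assms by (auto simp: subst_seq_def add_ac)
qed

lemma plus_right:
  assumes "\<Gamma> \<tturnstile> {#A#} + {#B#} + \<Delta>" "wf \<Gamma>" "wf \<Delta>" "A \<in> formulas L" "B \<in> formulas L" "\<not> s"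
  shows "\<Gamma> \<tturnstile> {#Plus A B#} + \<Delta>"
proof -
  have "([({#Ctx 0#}, {#Frm (Atm (FVar 0)), Frm (Atm (FVar 1)), Ctx 2#})],
      ({#Ctx 0#}, {#Frm (Plus (Atm (FVar 0)) (Atm (FVar 1))), Ctx 2#})) \<in> plus_rules"
    unfolding plus_rules_def Let_def by (rule insertI1 | rule insertI2)+
  from apply_rule[OF subsetD[OF conjunct2[OF plus[OF assms(6)]] this], of A B \<Gamma> "{#}" \<Delta> "{#}"] show ?thesis
    using assms by (auto simp: subst_seq_def add_ac)
qed

lemma top_right:
  assumes "top_bot_axioms side1 \<subseteq> rules K" "wf \<Gamma>" "wf \<Delta>" "s \<Longrightarrow> \<Delta> = {#}"
  shows "\<Gamma> \<tturnstile> {#Top#} + \<Delta>"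
proof -
  have "([],
      ({#Ctx 0#}, {#Frm Top#} + side1)) \<in> top_bot_axioms side1"
    unfolding top_bot_axioms_def Let_def by (rule insertI1 | rule insertI2)+
  from apply_rule[OF subsetD[OF assms(1) this], of One One \<Gamma> "{#}" \<Delta> "{#}"] show ?thesis
    using assms by (cases s) (auto simp: subst_seq_def add_ac)
qed

lemma bot_left:
  assumes "top_bot_axioms side1 \<subseteq> rules K" "wf \<Gamma>" "wf \<Delta>" "s \<Longrightarrow> size \<Delta> \<le> 1"
  shows "\<Gamma> + {#Bot#} \<tturnstile> \<Delta>"
proof -
  have "([],
      ({#Ctx 0, Frm Bot#}, {#Ctx 2#})) \<in> top_bot_axioms side1"
    unfolding top_bot_axioms_def Let_def by (rule insertI1 | rule insertI2)+
  from apply_rule[OF subsetD[OF assms(1) this], of One One \<Gamma> "{#}" \<Delta> "{#}"] show ?thesis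
    using assms by (auto simp: subst_seq_def add_ac)
qed

section \<open>Iterated fusion as the comma on the left, iterated plus as the comma on the
  right\<close>

lemma fusion_formula [simp]: "wf (mset As) \<Longrightarrow> fusion As \<in> formulas L"
  by (induction As) auto

lemma psum_formula [simp]: "\<not> s \<Longrightarrow> wf (mset As) \<Longrightarrow> psum As \<in> formulas L"
  by (induction As) auto

lemma fusion_right: "wf (mset As) \<Longrightarrow> mset As \<tturnstile> {#fusion As#}"
proof (induction As)
  case Nil
  then show ?case using one_right by simp
next
  case (Cons A As)
  then have "{#A#} + mset As \<tturnstile> {#Fus A (fusion As)#} + {#} + {#}"
    by (intro fus_right) (auto intro: identity)
  then show ?case by simp
qed

text \<open>Together with \<open>fusion_right\<close> this lets one formula stand for a list on the
  left without any cut. The context is generalised in the induction because the head formula joins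
  it before the tail is fused.\<close>

lemma fusion_left:
  assumes "\<Gamma> + mset As \<tturnstile> \<Delta>" "wf \<Gamma>" "wf (mset As)" "wf \<Delta>" "s \<Longrightarrow> size \<Delta> \<le> 1"
  shows "\<Gamma> + {#fusion As#} \<tturnstile> \<Delta>"
  using assms
proof (induction As arbitrary: \<Gamma>)
  case Nil
  then show ?case using one_left by simp
next
  case (Cons A As)
  have "\<Gamma> + {#A#} + {#fusion As#} \<tturnstile> \<Delta>"
    using Cons.prems by (intro Cons.IH) auto
  then show ?case
    using Cons.prems fus_left by simp
qed

lemma psum_left:
  assumes "\<not> s"
  shows "wf (mset As) \<Longrightarrow> {#psum As#} \<tturnstile> mset As"
proof (induction As)
  case Nil
  then show ?case using zero_left by simp
next
  case (Cons A As)
  then have "{#} + {#} + {#Plus A (psum As)#} \<tturnstile> {#A#} + mset As"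
    using assms by (intro plus_left) (auto intro: identity)
  then show ?case by simp
qed

text \<open>Dual to \<open>fusion_left\<close>: here the right context is generalised, and takes up
  the head formula while the tail is summed.\<close>

lemma psum_right:
  assumes "\<Gamma> \<tturnstile> mset As + \<Delta>" "wf \<Gamma>" "wf (mset As)" "wf \<Delta>" "\<not> s"
  shows "\<Gamma> \<tturnstile> {#psum As#} + \<Delta>"
  using assms
proof (induction As arbitrary: \<Delta>)
  case Nil
  then show ?case using zero_right by simp
next
  case (Cons A As)
  have "\<Gamma> \<tturnstile> {#psum As#} + ({#A#} + \<Delta>)"
    using Cons.prems by (intro Cons.IH) auto
  then have "\<Gamma> \<tturnstile> {#A#} + {#psum As#} + \<Delta>"
    by (simp add: add_mset_commute)
  from plus_right[OF this] show ?case
    using Cons.prems by simp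
qed


section \<open>Interpolants of axioms\<close>

text \<open>The size bound refers to the end sequent only. The constant comes from the largest
  interpolant, \<open>Plus (psum As) Bot\<close>: 15 bits for the outer \<open>Plus\<close>, 7 for
  the constant in the bound on \<open>psum\<close>, 5 for \<open>Bot\<close>.\<close>

definition interpolant :: "formula multiset \<Rightarrow> formula multiset \<Rightarrow> formula multiset \<Rightarrow>
    formula multiset \<Rightarrow> formula \<Rightarrow> bool" where
  "interpolant \<Sigma> \<Lambda> \<Theta> \<Delta> C \<longleftrightarrow> C \<in> formulas L \<and>
    \<Sigma> \<tturnstile> {#C#} + \<Theta> \<and> \<Lambda> + {#C#} \<tturnstile> \<Delta> \<and> vars C \<subseteq> V (\<Sigma> + \<Theta>) \<inter> V (\<Lambda> + \<Delta>) \<and>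
    length (enc_fm C) \<le> 9 * (weight (\<Sigma> + \<Lambda>) + weight (\<Theta> + \<Delta>)) + 27"

text \<open>Each copy of \<open>A\<close> may fall into either part. If both fall into the same
  part, the constant \<open>Zero\<close> or \<open>One\<close> interpolates; if they are separated,
  the variables of \<open>A\<close> are common, and \<open>A\<close> or its negation does.\<close>

lemma interpolant_identity:
  assumes "A \<in> formulas L" "\<Sigma> + \<Lambda> = {#A#}" "\<Theta> + \<Delta> = {#A#}" "s \<Longrightarrow> \<Theta> = {#}"
  shows "\<exists>C. interpolant \<Sigma> \<Lambda> \<Theta> \<Delta> C"
proof -
  note id = identity[OF assms(1)]
  have len: "length (enc_fm A) = weight {#A#}"
    by (simp add: weight_def)
  consider "\<Sigma> = {#A#}" "\<Lambda> = {#}" "\<Theta> = {#A#}" "\<Delta> = {#}"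
    | "\<Sigma> = {#A#}" "\<Lambda> = {#}" "\<Theta> = {#}" "\<Delta> = {#A#}"
    | "\<Sigma> = {#}" "\<Lambda> = {#A#}" "\<Theta> = {#A#}" "\<Delta> = {#}"
    | "\<Sigma> = {#}" "\<Lambda> = {#A#}" "\<Theta> = {#}" "\<Delta> = {#A#}"
    using assms(2,3) unfolding union_is_single by blast
  then show ?thesis
  proof cases
    case 1
    then have "interpolant \<Sigma> \<Lambda> \<Theta> \<Delta> Zero"
      using zero_right[OF id] zero_left assms(1,4) by (auto simp: interpolant_def)
    then show ?thesis ..
  next
    case 2
    then have "interpolant \<Sigma> \<Lambda> \<Theta> \<Delta> A"
      using id assms(1) len by (auto simp: interpolant_def)
    then show ?thesis ..
  next
    case 3
    \<comment> \<open>The copies lie crosswise, the left one in the second part and the right one in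
      the first. The negation \<open>Imp A Zero\<close> moves \<open>A\<close> to the opposite side
      of each sequent.\<close>
    then have "\<not> s" using assms(4) by auto
    then have "{#} + {#A#} \<tturnstile> {#Zero#} + {#A#}"
      using zero_right[OF id] assms(1) by simp
    then have "{#} \<tturnstile> {#Imp A Zero#} + {#A#}"
      using \<open>\<not> s\<close> assms(1) by (intro imp_right) auto
    moreover have "{#A#} + {#} + {#Imp A Zero#} \<tturnstile> {#} + {#}"
      using \<open>\<not> s\<close> assms(1) id zero_left by (intro imp_left) auto
    ultimately have "interpolant \<Sigma> \<Lambda> \<Theta> \<Delta> (Imp A Zero)"
      using 3 assms(1) len by (auto simp: interpolant_def V_def)
    then show ?thesis ..
  next
    case 4
    then have "interpolant \<Sigma> \<Lambda> \<Theta> \<Delta> One"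
      using one_left[OF id] one_right assms(1) by (auto simp: interpolant_def)
    then show ?thesis ..
  qed
qed

text \<open>If \<open>\<Theta>\<close> is empty, the first part has no variables and
  \<open>One\<close> is taken. Otherwise the sum of \<open>\<Delta>\<close> works, as its variables
  all occur in \<open>\<Theta>\<close> by uniformity.\<close>

lemma interpolant_right:
  assumes "{#} \<tturnstile> \<Theta> + \<Delta>" "wf (\<Theta> + \<Delta>)" "uniform (\<Theta> + \<Delta>)"
    and "s \<Longrightarrow> \<Theta> = {#} \<and> size \<Delta> \<le> 1"
  shows "\<exists>C. interpolant {#} {#} \<Theta> \<Delta> C"
proof (cases "\<Theta> = {#}")
  case True
  then have "interpolant {#} {#} \<Theta> \<Delta> One"
    using assms one_left[of "{#}" \<Delta>] one_right by (auto simp: interpolant_def)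
  then show ?thesis ..
next
  case False
  then have "\<not> s" using assms(4) by auto
  obtain As where As: "\<Delta> = mset As" by (metis ex_mset)
  have "{#} \<tturnstile> {#psum As#} + \<Theta>"
    using assms(1,2) As \<open>\<not> s\<close> by (intro psum_right) (auto simp: add.commute)
  then have "interpolant {#} {#} \<Theta> \<Delta> (psum As)"
    using assms(2) psum_left[OF \<open>\<not> s\<close>] As \<open>\<not> s\<close> length_enc_psum[of As]
      uniform_V[OF assms(3) False]
    by (auto simp: interpolant_def vars_psum)
  then show ?thesis ..
qed

text \<open>If \<open>\<Lambda>\<close> is empty, the interpolant must be free of variables and
  \<open>Zero\<close> is taken. Otherwise the fusion of \<open>\<Sigma>\<close> works, as its
  variables all occur in \<open>\<Lambda>\<close> by uniformity.\<close>

lemma interpolant_left: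
  assumes "\<Sigma> + \<Lambda> \<tturnstile> {#}" "wf (\<Sigma> + \<Lambda>)" "uniform (\<Sigma> + \<Lambda>)"
  shows "\<exists>C. interpolant \<Sigma> \<Lambda> {#} {#} C"
proof (cases "\<Lambda> = {#}")
  case True
  then have "interpolant \<Sigma> \<Lambda> {#} {#} Zero"
    using assms zero_right[of \<Sigma> "{#}"] zero_left by (auto simp: interpolant_def)
  then show ?thesis ..
next
  case False
  obtain As where As: "\<Sigma> = mset As" by (metis ex_mset)
  have "\<Lambda> + {#fusion As#} \<tturnstile> {#}"
    using assms(1,2) As by (intro fusion_left) (auto simp: add.commute)
  moreover have "uniform (\<Lambda> + \<Sigma>)"
    using assms(3) by (simp add: add.commute)
  ultimately have "interpolant \<Sigma> \<Lambda> {#} {#} (fusion As)"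
    using assms(2) fusion_right[of As] As length_enc_fusion[of As] uniform_V[OF _ False, of \<Sigma>]
    by (auto simp: interpolant_def vars_fusion)
  then show ?thesis ..
qed

text \<open>If all active formulas lie in \<open>\<Sigma>\<close>, the first part is itself an
  instance of the axiom and \<open>Bot\<close> interpolates. Otherwise the active formulas of
  \<open>\<Sigma>\<close> are fused, and \<open>Top\<close> swallows the passive ones, whose
  variables need not be common.\<close>

lemma interpolant_context_left:
  assumes tb: "top_bot_axioms side1 \<subseteq> rules K"
    and split: "\<Sigma> + \<Lambda> = \<Gamma> + M"
    and wf: "wf (\<Sigma> + \<Lambda>)" "wf (\<Theta> + \<Delta>)" and unif: "uniform M"
    and ax: "\<And>\<Gamma>' \<Delta>'. wf \<Gamma>' \<Longrightarrow> wf \<Delta>' \<Longrightarrow> (s \<Longrightarrow> size \<Delta>' \<le> 1) \<Longrightarrow> \<Gamma>' + M \<tturnstile> \<Delta>'"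
    and single: "s \<Longrightarrow> \<Theta> = {#} \<and> size \<Delta> \<le> 1"
  shows "\<exists>C. interpolant \<Sigma> \<Lambda> \<Theta> \<Delta> C"
proof -
  obtain \<Sigma>1 \<Sigma>2 \<Lambda>1 \<Lambda>2 where parts: "\<Sigma> = \<Sigma>1 + \<Sigma>2" "\<Lambda> = \<Lambda>1 + \<Lambda>2" "M = \<Sigma>1 + \<Lambda>1"
    using mset_split[OF split] by metis
  show ?thesis
  proof (cases "\<Lambda>1 = {#}")
    case True
    have "\<Sigma>2 + M \<tturnstile> {#Bot#} + \<Theta>"
      using wf parts single by (intro ax) auto
    then have "interpolant \<Sigma> \<Lambda> \<Theta> \<Delta> Bot"
      using True parts wf single bot_left[OF tb, of \<Lambda> \<Delta>] by (auto simp: interpolant_def add.commute)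
    then show ?thesis ..
  next
    case False
    obtain As where As: "\<Sigma>1 = mset As" by (metis ex_mset)
    let ?C = "Fus (fusion As) Top"
    have "\<Sigma>1 + \<Sigma>2 \<tturnstile> {#?C#} + {#} + \<Theta>"
      using wf parts single As fusion_right[of As] top_right[OF tb, of \<Sigma>2 \<Theta>]
      by (intro fus_right) auto
    \<comment> \<open>The active formulas handed over from \<open>\<Sigma>\<close> complete
      \<open>M\<close>, so the axiom applies again with \<open>Top\<close> in its left
      context.\<close>
    moreover have "(\<Lambda>2 + {#Top#}) + M \<tturnstile> \<Delta>"
      using wf parts single by (intro ax) auto
    then have "(\<Lambda> + {#Top#}) + mset As \<tturnstile> \<Delta>"
      using parts As by (simp add: ac_simps)
    then have "(\<Lambda> + {#Top#}) + {#fusion As#} \<tturnstile> \<Delta>"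
      using wf parts single As by (intro fusion_left) auto
    then have "\<Lambda> + {#?C#} \<tturnstile> \<Delta>"
      using wf parts single As by (intro fus_left) (auto simp: add_mset_commute)
    moreover have "V \<Sigma>1 \<subseteq> V \<Lambda>1"
      using uniform_V[OF _ False, of \<Sigma>1] unif parts by (simp add: add.commute)
    ultimately have "interpolant \<Sigma> \<Lambda> \<Theta> \<Delta> ?C"
      using parts wf As length_enc_fusion[of As]
      by (auto simp: interpolant_def vars_fusion)
    then show ?thesis ..
  qed
qed

text \<open>When one part holds all active formulas, it is an instance of the axiom by itself, and
  \<open>Top\<close> or \<open>Bot\<close> interpolates. When they are truly divided, the active
  formulas of \<open>\<Delta>\<close> are summed, with \<open>Bot\<close> added for the passive
  formulas of the second part.\<close>

lemma interpolant_context_right: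
  assumes tb: "top_bot_axioms side1 \<subseteq> rules K"
    and split: "\<Theta> + \<Delta> = \<Pi> + M"
    and wf: "wf (\<Sigma> + \<Lambda>)" "wf (\<Theta> + \<Delta>)" and unif: "uniform M"
    and ax: "\<And>\<Gamma>' \<Pi>'. wf \<Gamma>' \<Longrightarrow> wf \<Pi>' \<Longrightarrow> (s \<Longrightarrow> \<Pi>' = \<Pi>) \<Longrightarrow> \<Gamma>' \<tturnstile> \<Pi>' + M"
    and single: "s \<Longrightarrow> \<Theta> = {#} \<and> size \<Delta> \<le> 1"
  shows "\<exists>C. interpolant \<Sigma> \<Lambda> \<Theta> \<Delta> C"
proof -
  obtain \<Theta>1 \<Theta>2 \<Delta>1 \<Delta>2 where parts: "\<Theta> = \<Theta>1 + \<Theta>2" "\<Delta> = \<Delta>1 + \<Delta>2" "M = \<Theta>1 + \<Delta>1"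
    "\<Pi> = \<Theta>2 + \<Delta>2"
    using mset_split[OF split] by metis
  consider "\<Theta>1 = {#}" | "\<Theta>1 \<noteq> {#}" "\<Delta>1 = {#}" | "\<Theta>1 \<noteq> {#}" "\<Delta>1 \<noteq> {#}"
    by blast
  then show ?thesis
  proof cases
    case 1
    \<comment> \<open>In the single-conclusion case \<open>\<Theta>2\<close> is empty, so
      \<open>\<Delta>2\<close> is the original context \<open>\<Pi>\<close>, as \<open>ax\<close>
      demands.\<close>
    have "\<Lambda> + {#Top#} \<tturnstile> \<Delta>2 + M"
      using wf parts single by (intro ax) auto
    then have "interpolant \<Sigma> \<Lambda> \<Theta> \<Delta> Top"
      using 1 parts wf single top_right[OF tb, of \<Sigma> \<Theta>] by (auto simp: interpolant_def add.commute)
    then show ?thesis ..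
  next
    case 2
    then have "\<not> s" using single parts by auto
    then have "\<Sigma> \<tturnstile> (\<Theta>2 + {#Bot#}) + M"
      using wf parts by (intro ax) auto
    then have "interpolant \<Sigma> \<Lambda> \<Theta> \<Delta> Bot"
      using 2 \<open>\<not> s\<close> parts wf bot_left[OF tb, of \<Lambda> \<Delta>]
      by (auto simp: interpolant_def add.commute)
    then show ?thesis ..
  next
    case 3
    then have "\<not> s" using single parts by auto
    obtain As where As: "\<Delta>1 = mset As" by (metis ex_mset)
    let ?C = "Plus (psum As) Bot"
    \<comment> \<open>The right context is free here, so it can carry the summand
      \<open>Bot\<close>; in the other sequent \<open>Bot\<close> then derives
      \<open>\<Delta>2\<close> from \<open>\<Lambda>\<close>.\<close>
    have "\<Sigma> \<tturnstile> (\<Theta>2 + {#Bot#}) + M"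
      using wf parts \<open>\<not> s\<close> by (intro ax) auto
    then have "\<Sigma> \<tturnstile> mset As + ({#Bot#} + \<Theta>)"
      using parts As by (simp add: ac_simps)
    then have "\<Sigma> \<tturnstile> {#psum As#} + ({#Bot#} + \<Theta>)"
      using wf parts As \<open>\<not> s\<close> by (intro psum_right) auto
    then have "\<Sigma> \<tturnstile> {#?C#} + \<Theta>"
      using wf parts As \<open>\<not> s\<close> by (intro plus_right) auto
    moreover have "{#} + \<Lambda> + {#?C#} \<tturnstile> \<Delta>1 + \<Delta>2"
      using wf parts As \<open>\<not> s\<close> psum_left[of As] bot_left[OF tb, of \<Lambda> \<Delta>2]
      by (intro plus_left) auto
    moreover have "V \<Delta>1 \<subseteq> V \<Theta>1"
      using uniform_V[OF _ 3(1)] unif parts by simp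
    ultimately have "interpolant \<Sigma> \<Lambda> \<Theta> \<Delta> ?C"
      using parts wf As \<open>\<not> s\<close> length_enc_psum[of As]
      by (auto simp: interpolant_def vars_psum)
    then show ?thesis ..
  qed
qed

text \<open>With no hypotheses, the end sequent is an instance of a scheme of \<open>G\<close>,
  hence of a focused axiom. The case analysis on its form gives the interpolant, and the length of
  the proof is compared only at the end.\<close>

lemma interpolation:
  assumes over: "calculus_over L G" and G: "single_conclusion G = s"
    and GH: "\<And>S. provable L G S \<Longrightarrow> provable L H S"
    and axioms: "consists_of_context_free_focused_axioms G \<or>
      consists_of_focused_axioms G \<and> top_bot_axioms side1 \<subseteq> rules K"
    and \<pi>: "proof_from L G {} \<pi>" "root \<pi> = (\<Sigma> + \<Lambda>, \<Theta> + \<Delta>)"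
    and \<Theta>: "s \<Longrightarrow> \<Theta> = {#}"
  shows "\<exists>C. interpolant \<Sigma> \<Lambda> \<Theta> \<Delta> C \<and> length (enc_fm C) \<le> length (enc_proof \<pi>) ^ 3"
proof -
  let ?S = "(\<Sigma> + \<Lambda>, \<Theta> + \<Delta>)"
  obtain ts where ts: "\<pi> = Node ?S ts" "rule_instance L G (map root ts) ?S"
    using \<pi> by (cases rule: proof_from.cases) auto
  then obtain Ps Q \<sigma> \<tau> where r: "(Ps, Q) \<in> rules G" "\<And>n. \<sigma> n \<in> formulas L"
    "?S = subst_seq \<sigma> \<tau> Q"
    unfolding rule_instance_def by blast
  have single: "single_conclusion G \<Longrightarrow> size (snd ?S) \<le> 1"
    using ts(2) unfolding rule_instance_def by auto
  have wf: "wf (\<Sigma> + \<Lambda>)" "wf (\<Theta> + \<Delta>)"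
    using rule_instance_formulas[OF over ts(2)] by auto
  have S: "\<Sigma> + \<Lambda> \<tturnstile> \<Theta> + \<Delta>"
    using \<pi> by (intro GH) (auto simp: provable_from_def)
  have single': "s \<Longrightarrow> \<Theta> = {#} \<and> size \<Delta> \<le> 1"
    using single G \<Theta> by auto
  \<comment> \<open>This is settled first because such instances arise under both alternatives for
    \<open>G\<close>.\<close>
  have context_free: "\<exists>C. interpolant \<Sigma> \<Lambda> \<Theta> \<Delta> C" if "context_free_focused_axiom (Ps, Q)"
    using that
  proof (cases rule: context_free_instance_cases[where \<sigma> = \<sigma> and \<tau> = \<tau>])
    case (identity A)
    then show ?thesis
      using interpolant_identity[of A] r(3) wf \<Theta> by simp
  next
    case (right M)
    then have "\<Sigma> = {#}" "\<Lambda> = {#}" "\<Theta> + \<Delta> = M"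
      using r(3) by auto
    then show ?thesis
      using interpolant_right[of \<Theta> \<Delta>] S wf right(1) single' by simp
  next
    case (left M)
    then have "\<Theta> = {#}" "\<Delta> = {#}" "\<Sigma> + \<Lambda> = M"
      using r(3) by auto
    then show ?thesis
      using interpolant_left[of \<Sigma> \<Lambda>] S wf left(1) by simp
  qed
  have "\<exists>C. interpolant \<Sigma> \<Lambda> \<Theta> \<Delta> C"
    using axioms
  proof (elim disjE conjE)
    assume "consists_of_context_free_focused_axioms G"
    then show ?thesis
      using context_free r(1) unfolding consists_of_context_free_focused_axioms_def by blast
  next
    assume foc: "consists_of_focused_axioms G" and tb: "top_bot_axioms side1 \<subseteq> rules K"
    have ax: "focused_axiom (single_conclusion G) (Ps, Q)"
      using foc r(1) unfolding consists_of_focused_axioms_def by blast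
    have size: "single_conclusion G \<longrightarrow> size (snd (subst_seq \<sigma> \<tau> Q)) \<le> 1"
      using single r(3) by simp
    from ax r(1,2) size show ?thesis
    proof (cases rule: focused_instance_cases)
      case context_free
      then show ?thesis by fact
    next
      \<comment> \<open>The axioms with new contexts are theorems of \<open>G\<close> and pass to
        \<open>H\<close> by \<open>GH\<close>.\<close>
      case (context_left \<Gamma> M \<Delta>')
      then show ?thesis
        using r(3) G by (intro interpolant_context_left[OF tb _ wf _ _ single', of \<Gamma> M] GH) auto
    next
      case (context_right \<Gamma> M \<Pi>)
      then show ?thesis
        using r(3) G by (intro interpolant_context_right[OF tb _ wf _ _ single', of \<Pi> M] GH) auto
    qed
  qed
  then obtain C where C: "interpolant \<Sigma> \<Lambda> \<Theta> \<Delta> C" ..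
  let ?n = "length (enc_proof \<pi>)"
  have n: "weight (\<Sigma> + \<Lambda>) + weight (\<Theta> + \<Delta>) + 3 \<le> ?n"
    using weight_le_length_enc_proof[of ?S ts] ts(1) by simp
  \<comment> \<open>The constant 27 is 9 times the 3 spare bits of the proof code. Since
    \<open>?n\<close> is at least 3, the factor 9 is in turn at most the square of
    \<open>?n\<close>, which gives the exponent 3.\<close>
  have "length (enc_fm C) \<le> 9 * ?n"
    using C n by (simp add: interpolant_def)
  also have "\<dots> \<le> ?n ^ 2 * ?n"
    using n power_mono[of 3 ?n 2] by (intro mult_right_mono) auto
  also have "\<dots> = ?n ^ 3"
    by (simp add: power2_eq_square power3_eq_cube)
  finally show ?thesis
    using C by blast
qed

end

section \<open>The four base calculi and the two interpolation properties\<close>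

lemma fle_extension_single:
  assumes "base_language \<subseteq> L" "extends L H K" "K = FLe \<or> K = FLe_minus"
  shows "fle_extension L H K True"
  using assms by unfold_locales (auto simp: FLe_def FLe_minus_def)

lemma fle_extension_multi:
  assumes "base_language \<subseteq> L" "(CPlus, 2) \<in> L" "extends L H K" "K = CFLe \<or> K = CFLe_minus"
  shows "fle_extension L H K False"
  using assms by unfold_locales (auto simp: CFLe_def CFLe_minus_def)

lemma feasible_interpolation_single:
  assumes "base_language \<subseteq> L" "calculus_over L G" "\<And>S. provable L G S \<Longrightarrow> provable L H S"
    and "single_conclusion G"
    and "consists_of_focused_axioms G \<and> extends L H FLe \<or>
      consists_of_context_free_focused_axioms G \<and> extends L H FLe_minus"
  shows "feasible_interpolation L H G"
proof -
  have tb: "top_bot_axioms {#} \<subseteq> rules FLe"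
    by (auto simp: FLe_def)
  \<comment> \<open>\<open>K\<close> is \<open>FLe\<close> if the axioms are focused and
    \<open>FLe_minus\<close> if they are context-free, so the axioms for \<open>Top\<close> and
    \<open>Bot\<close> are at hand exactly where contexts must be absorbed.\<close>
  obtain K where K: "fle_extension L H K True" "consists_of_context_free_focused_axioms G \<or>
      consists_of_focused_axioms G \<and> top_bot_axioms {#} \<subseteq> rules K"
    using assms(5) fle_extension_single[OF assms(1)] tb by blast
  interpret fle_extension L H K True by (rule K(1))
  show ?thesis
    unfolding feasible_interpolation_def
  proof (intro exI[of _ 3] allI impI, elim conjE)
    fix \<Sigma> \<Lambda> \<Delta> \<pi>
    assume "proof_from L G {} \<pi>" "root \<pi> = (\<Sigma> + \<Lambda>, \<Delta>)"
    then obtain C where "interpolant \<Sigma> \<Lambda> {#} \<Delta> C" "length (enc_fm C) \<le> length (enc_proof \<pi>) ^ 3"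
      using interpolation[OF assms(2) _ assms(3), of \<pi> \<Sigma> \<Lambda> "{#}" \<Delta>] assms(4) K(2) by auto
    then show "\<exists>C \<in> formulas L. provable L H (\<Sigma>, {#C#}) \<and> provable L H (\<Lambda> + {#C#}, \<Delta>) \<and>
        vars C \<subseteq> V \<Sigma> \<inter> V (\<Lambda> + \<Delta>) \<and> length (enc_fm C) \<le> length (enc_proof \<pi>) ^ 3"
      by (intro bexI[of _ C]) (simp_all add: interpolant_def)
  qed
qed

lemma strong_feasible_interpolation_multi:
  assumes "base_language \<subseteq> L" "calculus_over L G" "\<And>S. provable L G S \<Longrightarrow> provable L H S"
    and "\<not> single_conclusion G" "(CPlus, 2) \<in> L"
    and "consists_of_focused_axioms G \<and> extends L H CFLe \<or>
      consists_of_context_free_focused_axioms G \<and> extends L H CFLe_minus"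
  shows "strong_feasible_interpolation L H G"
proof -
  have tb: "top_bot_axioms {#Ctx 2#} \<subseteq> rules CFLe"
    by (auto simp: CFLe_def)
  obtain K where K: "fle_extension L H K False" "consists_of_context_free_focused_axioms G \<or>
      consists_of_focused_axioms G \<and> top_bot_axioms {#Ctx 2#} \<subseteq> rules K"
    using assms(6) fle_extension_multi[OF assms(1,5)] tb by blast
  interpret fle_extension L H K False by (rule K(1))
  show ?thesis
    unfolding strong_feasible_interpolation_def
  proof (intro exI[of _ 3] allI impI, elim conjE)
    fix \<Sigma> \<Lambda> \<Theta> \<Delta> \<pi>
    assume "proof_from L G {} \<pi>" "root \<pi> = (\<Sigma> + \<Lambda>, \<Theta> + \<Delta>)"
    then obtain C where "interpolant \<Sigma> \<Lambda> \<Theta> \<Delta> C" "length (enc_fm C) \<le> length (enc_proof \<pi>) ^ 3"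
      using interpolation[OF assms(2) _ assms(3), of \<pi> \<Sigma> \<Lambda> \<Theta> \<Delta>] assms(4) K(2) by auto
    then show "\<exists>C \<in> formulas L. provable L H (\<Sigma>, {#C#} + \<Theta>) \<and> provable L H (\<Lambda> + {#C#}, \<Delta>) \<and>
        vars C \<subseteq> V (\<Sigma> + \<Theta>) \<inter> V (\<Lambda> + \<Delta>) \<and> length (enc_fm C) \<le> length (enc_proof \<pi>) ^ 3"
      by (intro bexI[of _ C]) (simp_all add: interpolant_def)
  qed
qed

theorem theorem4p3:
  fixes L :: language and G H :: calculus
  assumes "base_language \<subseteq> L"
    and "calculus_over L G" and "calculus_over L H"
    and "\<And>S. provable L G S \<Longrightarrow> provable L H S"
  shows "(single_conclusion G \<and> single_conclusion H \<longrightarrow>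
            (consists_of_focused_axioms G \<and> extends L H FLe
               \<longrightarrow> feasible_interpolation L H G) \<and>
            (consists_of_context_free_focused_axioms G \<and> extends L H FLe_minus
               \<longrightarrow> feasible_interpolation L H G)) \<and>
         (\<not> single_conclusion G \<and> \<not> single_conclusion H \<and> (CPlus, 2) \<in> L \<longrightarrow>
            (consists_of_focused_axioms G \<and> extends L H CFLe
               \<longrightarrow> strong_feasible_interpolation L H G) \<and>
            (consists_of_context_free_focused_axioms G \<and> extends L H CFLe_minus
               \<longrightarrow> strong_feasible_interpolation L H G))"
  using feasible_interpolation_single[OF assms(1,2,4)] strong_feasible_interpolation_multi[OF assms(1,2,4)]
  by blast

end
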